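(* Let $d \geq 1$, $p,q \in [1,\infty]$ and $r \in (2,\infty]$. Then there is no constant $C$ such that the estimate $$ \| Uf \|_{L_t^p(\mathbb{R}, L_x^q(\mathbb{R}^d))} \leq C \| f \|_{L^r(\mathbb{R}^d)}$$ holds for all $f \in L^r_{rad}(\mathbb{R}^d)$.
   Context: $U(t) = e^{it\Delta}$ is the free Schrödinger propagator on $\mathbb{R}^d$, and $Uf$ denotes the function $(t,x) \mapsto (U(t)f)(x)$ for $f \in \mathcal{S}'(\mathbb{R}^d)$. $L^r_{rad}(\mathbb{R}^d)$ denotes the set of radially symmetric functions in $L^r(\mathbb{R}^d)$. *)

theory Defs
  imports "HOL-Probability.Essential_Supremum"
begin

section \<open>Lebesgue norms\<close>

definition ennpowr :: "ennreal \<Rightarrow> real \<Rightarrow> ennreal" where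
  "ennpowr x a = (if x = \<infinity> then \<infinity> else ennreal (enn2real x powr a))"

text \<open>The \<open>L\<^sup>p\<close> norm of a \<open>[0,\<infinity>]\<close>-valued function, meant for exponents \<open>1 \<le> p \<le> \<infinity>\<close>.\<close>

definition Lp_ennnorm :: "ennreal \<Rightarrow> 'a measure \<Rightarrow> ('a \<Rightarrow> ennreal) \<Rightarrow> ennreal" where
  "Lp_ennnorm p M h =
     (if p = \<infinity> then esssup M h
      else ennpowr (\<integral>\<^sup>+ x. ennpowr (h x) (enn2real p) \<partial>M) (1 / enn2real p))"

definition Lp_norm :: "ennreal \<Rightarrow> ('a::euclidean_space \<Rightarrow> complex) \<Rightarrow> ennreal" where
  "Lp_norm p f = Lp_ennnorm p lborel (\<lambda>x. ennreal (norm (f x)))"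

text \<open>Elements of \<open>L\<^sup>p\<close> are given by Borel representatives (every class has one).\<close>

definition Lp_space :: "ennreal \<Rightarrow> ('a::euclidean_space \<Rightarrow> complex) set" where
  "Lp_space p = {f. f \<in> borel_measurable lborel \<and> Lp_norm p f < \<infinity>}"

text \<open>Radial symmetry is a property of the class of \<open>f\<close>, hence the \<open>AE\<close>.\<close>

definition Lp_rad :: "ennreal \<Rightarrow> ('a::euclidean_space \<Rightarrow> complex) set" where
  "Lp_rad p = {f \<in> Lp_space p. \<exists>F. AE x in lborel. f x = F (norm x)}"


section \<open>Schwartz functions and tempered distributions\<close>

definition partial_deriv ::
    "'a::euclidean_space \<Rightarrow> ('a \<Rightarrow> complex) \<Rightarrow> 'a \<Rightarrow> complex" where
  "partial_deriv b \<phi> = (\<lambda>x. frechet_derivative \<phi> (at x) b)"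

text \<open>
  A list \<open>bs\<close> of basis vectors plays the role of a multi-index. Requiring every iterated
  partial derivative to be differentiable amounts to smoothness.
\<close>

definition schwartz :: "('a::euclidean_space \<Rightarrow> complex) set" where
  "schwartz = {\<phi>. \<forall>bs \<in> lists Basis.
      (\<forall>x. foldr partial_deriv bs \<phi> differentiable at x) \<and>
      (\<forall>k::nat. bounded (range (\<lambda>x. (1 + norm x) ^ k *\<^sub>R foldr partial_deriv bs \<phi> x)))}"

text \<open>
  A tempered distribution is represented by the functional \<open>\<phi> \<mapsto> \<langle>T, \<phi>\<rangle>\<close> (bilinear
  pairing). Only its values on \<^const>\<open>schwartz\<close> are meaningful; the operations below are
  transposes of maps that send Schwartz functions to Schwartz functions.
\<close>

type_synonym 'a distr = "('a \<Rightarrow> complex) \<Rightarrow> complex"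

definition distr_of :: "('a::euclidean_space \<Rightarrow> complex) \<Rightarrow> 'a distr" where
  "distr_of f = (\<lambda>\<phi>. \<integral>x. f x * \<phi> x \<partial>lborel)"

definition fourier :: "('a::euclidean_space \<Rightarrow> complex) \<Rightarrow> 'a \<Rightarrow> complex" where
  "fourier \<phi> = (\<lambda>\<xi>. \<integral>x. exp (- \<i> * complex_of_real (x \<bullet> \<xi>)) * \<phi> x \<partial>lborel)"

definition inv_fourier :: "('a::euclidean_space \<Rightarrow> complex) \<Rightarrow> 'a \<Rightarrow> complex" where
  "inv_fourier \<phi> = (\<lambda>x. complex_of_real (1 / (2 * pi) ^ DIM('a)) *
     (\<integral>\<xi>. exp (\<i> * complex_of_real (x \<bullet> \<xi>)) * \<phi> \<xi> \<partial>lborel))"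

definition fourier_distr :: "'a::euclidean_space distr \<Rightarrow> 'a distr" where
  "fourier_distr T = (\<lambda>\<phi>. T (fourier \<phi>))"

definition inv_fourier_distr :: "'a::euclidean_space distr \<Rightarrow> 'a distr" where
  "inv_fourier_distr T = (\<lambda>\<phi>. T (inv_fourier \<phi>))"

definition mult_distr :: "('a::euclidean_space \<Rightarrow> complex) \<Rightarrow> 'a distr \<Rightarrow> 'a distr" where
  "mult_distr m T = (\<lambda>\<phi>. T (\<lambda>\<xi>. m \<xi> * \<phi> \<xi>))"


section \<open>The free Schroedinger propagator\<close>

text \<open>\<open>U(t) = exp (i t \<Delta>)\<close> is the Fourier multiplier with symbol \<open>exp (- i t \<bar>\<xi>\<bar>\<^sup>2)\<close>.\<close>

definition schrodinger :: "real \<Rightarrow> 'a::euclidean_space distr \<Rightarrow> 'a distr" where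
  "schrodinger t T = inv_fourier_distr
     (mult_distr (\<lambda>\<xi>. exp (- \<i> * complex_of_real (t * (norm \<xi>)\<^sup>2))) (fourier_distr T))"

text \<open>
  The \<open>L\<^sup>q\<close> norm of a tempered distribution: that of the \<open>L\<^sup>q\<close> function representing it,
  which is unique up to null sets, and \<open>\<infinity>\<close> (the infimum of the empty set) if there is none.
\<close>

definition Lp_norm_distr :: "ennreal \<Rightarrow> 'a::euclidean_space distr \<Rightarrow> ennreal" where
  "Lp_norm_distr q T =
     Inf {Lp_norm q g | g. g \<in> Lp_space q \<and> (\<forall>\<phi> \<in> schwartz. T \<phi> = distr_of g \<phi>)}"

definition mixed_norm ::
    "ennreal \<Rightarrow> ennreal \<Rightarrow> (real \<Rightarrow> 'a::euclidean_space distr) \<Rightarrow> ennreal" where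
  "mixed_norm p q u = Lp_ennnorm p lborel (\<lambda>t. Lp_norm_distr q (u t))"

end

theory Submission
  imports Defs "HOL-Probability.Distributions" "HOL-Complex_Analysis.Cauchy_Integral_Theorem" "HOL-Real_Asymp.Real_Asymp"
begin

text \<open>
  The mixed norm of \<open>U f\<close> is taken over all times, so replacing \<open>f\<close> by \<open>U(-T) f\<close> only translates
  \<open>U f\<close> in time and leaves its mixed norm unchanged. The \<open>L\<^sup>r\<close> norm of \<open>U(-T) f\<close>, on the other
  hand, decays as \<open>T \<rightarrow> \<infinity>\<close> when \<open>r > 2\<close>, by dispersion. Hence no estimate can hold: the data
  \<open>U(-T) f\<close> are tiny, but focus at time \<open>T\<close> to a profile of fixed size.

  For the standard Gaussian \<open>f\<close> everything is explicit, and the data are again radial: with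
  \<open>S = 1 + 4 T\<^sup>2\<close> and \<open>d\<close> the dimension, \<open>U(-T) f\<close> is up to a constant of modulus one the function
  \<open>chirp T x = S\<^bsup>- d / 4\<^esup> exp (- \<bar>x\<bar>\<^sup>2 / (2 (1 - 2 i T)))\<close>. Its \<open>L\<^sup>r\<close> norm is a constant times
  \<open>S\<^bsup>d / (2 r) - d / 4\<^esup>\<close>, which tends to \<open>0\<close> (\<open>Lp_norm_chirp_tendsto_0\<close>).

  The mixed norm need not be computed; a lower bound independent of \<open>T\<close> is enough
  (\<open>mixed_norm_chirp_ge\<close>). Pairing \<open>U(t) (chirp T)\<close> with the Schwartz function \<open>exp (- \<bar>x\<bar>\<^sup>2 / 2)\<close>
  gives a Gaussian integral whose modulus is at least a positive constant for \<open>\<bar>t - T\<bar> \<le> 1\<close>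
  (\<open>norm_schrodinger_chirp_ge\<close>). A function with such a pairing has \<open>L\<^sup>q\<close> norm bounded below
  (\<open>Lp_norm_ge_of_pairing\<close>), and since this happens on a time interval of length one, the
  \<open>L\<^sup>p\<close> norm in time is bounded below as well (\<open>Lp_ennnorm_ge_interval\<close>). The one analytic
  ingredient is the Fourier transform of \<open>exp (- w \<bar>x\<bar>\<^sup>2)\<close> for complex \<open>w\<close> with \<open>Re w > 0\<close>
  (\<open>complex_gaussian_fourier\<close>), obtained in one dimension by rotating the line of integration.
\<close>


section \<open>Complex Gaussian integrals\<close>

text \<open>
  A primitive of \<open>exp (- \<zeta>\<^sup>2)\<close> has the same limit at infinity along all translates of rays in the
  sector \<open>\<bar>Im \<zeta>\<bar> < Re \<zeta>\<close>: the segment between the two points has length \<open>O(R)\<close>, and the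
  integrand is of Gaussian size in \<open>R\<close> on it.
\<close>

lemma gaussian_primitive_rotate:
  fixes \<Phi> :: "complex \<Rightarrow> complex" and c z :: complex
  assumes \<Phi>: "\<And>\<zeta>. (\<Phi> has_field_derivative exp (- \<zeta>\<^sup>2)) (at \<zeta>)"
    and c: "\<bar>Im c\<bar> < Re c"
  shows "((\<lambda>R. \<Phi> (c * of_real R + z) - \<Phi> (of_real R)) \<longlongrightarrow> 0) at_top"
proof -
  \<comment> \<open>On the whole segment, \<open>Re \<zeta> - \<bar>Im \<zeta>\<bar>\<close> is at least \<open>m * R - 2 * norm z\<close>.\<close>
  define m where "m = min 1 (Re c - \<bar>Im c\<bar>)"
  define K where "K = norm (c - 1)"
  define N where "N = norm z"
  have m: "0 < m" "m \<le> 1" "m \<le> Re c - \<bar>Im c\<bar>"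
    using c by (auto simp: m_def)
  have bound: "norm (\<Phi> (c * of_real R + z) - \<Phi> (of_real R))
      \<le> exp (- (m * R - 2 * N)\<^sup>2) * (K * R + N)" if R: "R \<ge> 2 * N / m" "R > 0" for R
  proof -
    let ?S = "closed_segment (complex_of_real R) (c * of_real R + z)"
    have nonneg: "0 \<le> m * R - 2 * N"
      using R m by (simp add: field_simps)
    have "norm (exp (- \<zeta>\<^sup>2)) \<le> exp (- (m * R - 2 * N)\<^sup>2)" if "\<zeta> \<in> ?S" for \<zeta>
    proof -
      from that obtain u where u: "0 \<le> u" "u \<le> 1"
        and \<zeta>: "\<zeta> = (1 - u) *\<^sub>R of_real R + u *\<^sub>R (c * of_real R + z)"
        by (auto simp: in_segment)
      have Re: "Re \<zeta> = R * ((1 - u) + u * Re c) + u * Re z" and Im: "Im \<zeta> = u * (R * Im c) + u * Im z"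
        by (auto simp: \<zeta> algebra_simps)
      have "u * \<bar>Re z\<bar> \<le> 1 * N" "u * \<bar>Im z\<bar> \<le> 1 * N"
        using u abs_Re_le_cmod[of z] abs_Im_le_cmod[of z] unfolding N_def
        by (intro mult_mono; simp)+
      moreover have "- (u * \<bar>Re z\<bar>) \<le> u * Re z"
        using u by (metis abs_ge_minus_self abs_mult abs_of_nonneg minus_le_iff)
      moreover have "\<bar>Im \<zeta>\<bar> \<le> u * (R * \<bar>Im c\<bar>) + u * \<bar>Im z\<bar>"
        unfolding Im using u R by (intro order_trans[OF abs_triangle_ineq]) (simp add: abs_mult)
      moreover have "R * m \<le> R * ((1 - u) + u * (Re c - \<bar>Im c\<bar>))"
      proof (intro mult_left_mono)
        have "(1 - u) * m + u * m \<le> (1 - u) * 1 + u * (Re c - \<bar>Im c\<bar>)"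
          using u m by (intro add_mono mult_left_mono) auto
        then show "m \<le> (1 - u) + u * (Re c - \<bar>Im c\<bar>)" by (simp add: algebra_simps)
      qed (use R in simp)
      ultimately have diff: "m * R - 2 * N \<le> Re \<zeta> - \<bar>Im \<zeta>\<bar>"
        unfolding Re by (simp add: algebra_simps)
      have "(m * R - 2 * N)\<^sup>2 \<le> (Re \<zeta> - \<bar>Im \<zeta>\<bar>) * (Re \<zeta> + \<bar>Im \<zeta>\<bar>)"
        unfolding power2_eq_square using diff nonneg by (intro mult_mono) auto
      also have "\<dots> = Re (\<zeta>\<^sup>2)"
        by (simp add: Re_power2 algebra_simps power2_eq_square)
      finally show ?thesis by simp
    qed
    moreover have "(\<Phi> has_field_derivative exp (- \<zeta>\<^sup>2)) (at \<zeta> within ?S)" for \<zeta>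
      using \<Phi> by (rule has_field_derivative_at_within)
    ultimately have "norm (\<Phi> (c * of_real R + z) - \<Phi> (of_real R))
        \<le> exp (- (m * R - 2 * N)\<^sup>2) * norm (c * of_real R + z - of_real R)"
      by (intro field_differentiable_bound[where S = ?S]) auto
    also have "norm (c * of_real R + z - of_real R) \<le> norm ((c - 1) * of_real R) + norm z"
      by (intro order_trans[OF _ norm_triangle_ineq]) (simp add: algebra_simps)
    also have "\<dots> = K * R + N"
      using R by (simp add: K_def N_def norm_mult)
    finally show ?thesis by simp
  qed
  have "((\<lambda>R. exp (- (m * R - 2 * N)\<^sup>2) * R) \<longlongrightarrow> 0) at_top"
    "((\<lambda>R. exp (- (m * R - 2 * N)\<^sup>2)) \<longlongrightarrow> 0) at_top"
    using m by real_asymp+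
  then have "((\<lambda>R. K * (exp (- (m * R - 2 * N)\<^sup>2) * R) + N * exp (- (m * R - 2 * N)\<^sup>2))
      \<longlongrightarrow> K * 0 + N * 0) at_top"
    by (intro tendsto_intros)
  then have "((\<lambda>R. exp (- (m * R - 2 * N)\<^sup>2) * (K * R + N)) \<longlongrightarrow> 0) at_top"
    by (simp add: algebra_simps)
  moreover have "\<forall>\<^sub>F R in at_top. norm (\<Phi> (c * of_real R + z) - \<Phi> (of_real R))
      \<le> exp (- (m * R - 2 * N)\<^sup>2) * (K * R + N)"
    using eventually_ge_at_top[of "2 * N / m"] eventually_gt_at_top[of 0]
    by eventually_elim (rule bound)
  ultimately show ?thesis
    by (rule Lim_null_comparison[rotated])
qed

lemma real_gaussian_integral_1d:
  fixes a :: real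
  assumes "0 < a"
  shows "integrable lborel (\<lambda>x::real. exp (- a * x\<^sup>2))"
    and "(\<integral>x. exp (- a * (x::real)\<^sup>2) \<partial>lborel) = sqrt (pi / a)"
proof -
  define \<sigma> where "\<sigma> = sqrt (1 / (2 * a))"
  have \<sigma>: "\<sigma>\<^sup>2 = 1 / (2 * a)" "0 < \<sigma>" using assms by (auto simp: \<sigma>_def)
  have eq: "(\<lambda>x. exp (- a * x\<^sup>2)) = (\<lambda>x. sqrt (pi / a) * normal_density 0 \<sigma> x)"
    using assms by (auto simp: normal_density_def \<sigma> field_simps real_sqrt_divide)
  show "integrable lborel (\<lambda>x::real. exp (- a * x\<^sup>2))"
    unfolding eq using \<sigma> by (intro integrable_mult_right) auto
  show "(\<integral>x. exp (- a * (x::real)\<^sup>2) \<partial>lborel) = sqrt (pi / a)"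
    unfolding eq using \<sigma> by simp
qed

text \<open>
  Rotation of the line of integration: for a primitive \<open>\<Phi>\<close> of \<open>exp (- \<zeta>\<^sup>2)\<close>, the difference
  \<open>\<Phi> (c x + z) - \<Phi> x\<close> tends to \<open>0\<close> at both ends of the real line, so the integral of its
  derivative \<open>c exp (- (c x + z)\<^sup>2) - exp (- x\<^sup>2)\<close> vanishes.
\<close>

lemma complex_gaussian_1d:
  fixes c z :: complex
  assumes c: "\<bar>Im c\<bar> < Re c" and int: "integrable lborel (\<lambda>x::real. exp (- (c * of_real x + z)\<^sup>2))"
  shows "(\<integral>x. exp (- (c * of_real x + z)\<^sup>2) \<partial>lborel) = of_real (sqrt pi) / c"
proof -
  obtain \<Phi> :: "complex \<Rightarrow> complex" where "\<And>\<zeta>. (\<Phi> has_field_derivative exp (- \<zeta>\<^sup>2)) (at \<zeta> within UNIV)"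
    by (rule holomorphic_convex_primitive'[of UNIV "\<lambda>\<zeta>. exp (- \<zeta>\<^sup>2)"])
       (auto intro!: holomorphic_intros)
  then have \<Phi>: "\<And>\<zeta>. (\<Phi> has_field_derivative exp (- \<zeta>\<^sup>2)) (at \<zeta>)" by simp
  \<comment> \<open>The reflection \<open>\<Psi>\<close> is also a primitive; it serves for the limit at \<open>-\<infinity>\<close>.\<close>
  define \<Psi> where "\<Psi> \<zeta> = - \<Phi> (- \<zeta>)" for \<zeta>
  have \<Psi>: "(\<Psi> has_field_derivative exp (- \<zeta>\<^sup>2)) (at \<zeta>)" for \<zeta>
    unfolding \<Psi>_def by (rule derivative_eq_intros DERIV_chain'[OF _ \<Phi>] refl)+ simp
  define F where "F x = \<Phi> (c * of_real x + z) - \<Phi> (of_real x)" for x :: real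
  define f where "f x = c * exp (- (c * of_real x + z)\<^sup>2) - exp (- (of_real x)\<^sup>2)" for x :: real
  have real_eq: "exp (- (complex_of_real x)\<^sup>2) = of_real (exp (- 1 * x\<^sup>2))" for x
    by (simp flip: exp_of_real)
  have int1: "integrable lborel (\<lambda>x::real. exp (- (complex_of_real x)\<^sup>2))"
    unfolding real_eq by (intro integrable_of_real real_gaussian_integral_1d) simp
  have "(LBINT x=-\<infinity>..\<infinity>. f x) = 0 - 0"
  proof (rule interval_integral_FTC_integrable)
    show "(F has_vector_derivative f x) (at x)" for x
      unfolding F_def f_def
      by (rule derivative_eq_intros has_vector_derivative_real_field DERIV_chain'[OF _ \<Phi>] refl)+
         (auto simp: algebra_simps intro!: derivative_eq_intros)
    show "isCont f x" for x
      unfolding f_def by (intro continuous_intros)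
    show "set_integrable lborel (einterval (-\<infinity>) \<infinity>) f"
      unfolding f_def using int int1 by (simp add: set_integrable_def)
    show "((F \<circ> real_of_ereal) \<longlongrightarrow> 0) (at_left \<infinity>)"
      unfolding at_left_PInf tendsto_compose_filtermap[symmetric]
      using gaussian_primitive_rotate[OF \<Phi> c] by (simp add: F_def o_def filterlim_filtermap)
    have "((\<lambda>R. \<Psi> (c * of_real R + (- z)) - \<Psi> (of_real R)) \<longlongrightarrow> 0) at_top"
      by (rule gaussian_primitive_rotate[OF \<Psi> c])
    then have "((\<lambda>R. - F (- R)) \<longlongrightarrow> 0) at_top"
      by (simp add: F_def \<Psi>_def algebra_simps)
    then have "((\<lambda>R. F (- R)) \<longlongrightarrow> 0) at_top"
      by (auto dest: tendsto_minus)
    then have "(F \<longlongrightarrow> 0) at_bot"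
      by (simp add: at_bot_mirror filterlim_filtermap)
    then show "((F \<circ> real_of_ereal) \<longlongrightarrow> 0) (at_right (-\<infinity>))"
      unfolding at_right_MInf by (simp add: o_def filterlim_filtermap)
  qed simp
  then have "(\<integral>x. f x \<partial>lborel) = 0"
    by (simp add: interval_lebesgue_integral_def set_lebesgue_integral_def)
  then have "c * (\<integral>x. exp (- (c * of_real x + z)\<^sup>2) \<partial>lborel) = (\<integral>x. exp (- (complex_of_real x)\<^sup>2) \<partial>lborel)"
    unfolding f_def using int int1 by simp
  also have "\<dots> = of_real (sqrt pi)"
    unfolding real_eq using real_gaussian_integral_1d(2)[of 1]
    by (subst integral_complex_of_real) simp
  finally show ?thesis
    using c by (subst nonzero_eq_divide_eq) (auto simp: mult.commute)
qed

lemma Re_csqrt_gt_abs_Im: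
  assumes "0 < Re w"
  shows "\<bar>Im (csqrt w)\<bar> < Re (csqrt w)"
proof -
  have "(Im (csqrt w))\<^sup>2 < (Re (csqrt w))\<^sup>2"
    using assms Re_power2[of "csqrt w"] by (simp del: csqrt.simps)
  then show ?thesis
    using Re_csqrt[of w] by (metis abs_le_square_iff abs_of_nonneg not_le)
qed

lemma complex_gaussian_fourier_1d:
  fixes w :: complex and \<xi> :: real
  assumes w: "0 < Re w"
  shows "integrable lborel (\<lambda>x::real. exp (- w * of_real (x\<^sup>2) - \<i> * of_real (x * \<xi>)))" (is ?int)
    and "(\<integral>x. exp (- w * of_real (x\<^sup>2) - \<i> * of_real (x * \<xi>)) \<partial>lborel)
           = of_real (sqrt pi) / csqrt w * exp (- of_real (\<xi>\<^sup>2) / (4 * w))" (is ?eq)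
proof -
  show int: ?int
  proof (rule Bochner_Integration.integrable_bound)
    show "integrable lborel (\<lambda>x::real. exp (- Re w * x\<^sup>2))"
      using w by (rule real_gaussian_integral_1d)
  qed (auto simp del: of_real_power)
  \<comment> \<open>Completing the square.\<close>
  let ?c = "csqrt w" let ?z = "\<i> * of_real \<xi> / (2 * csqrt w)"
  have [simp]: "w \<noteq> 0" using w by auto
  have z2: "?z\<^sup>2 = - of_real (\<xi>\<^sup>2) / (4 * w)"
    by (simp add: power_divide power_mult_distrib)
  have sq: "- w * of_real (x\<^sup>2) - \<i> * of_real (x * \<xi>) = - (?c * of_real x + ?z)\<^sup>2 + - of_real (\<xi>\<^sup>2) / (4 * w)" for x
    unfolding power2_sum z2 by (simp add: power_mult_distrib)
  have "integrable lborel (\<lambda>x::real. exp (- (?c * of_real x + ?z)\<^sup>2) * exp (- of_real (\<xi>\<^sup>2) / (4 * w)))"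
    using int unfolding sq exp_add .
  then have "integrable lborel (\<lambda>x::real. exp (- (?c * of_real x + ?z)\<^sup>2) * exp (- of_real (\<xi>\<^sup>2) / (4 * w))
      * inverse (exp (- of_real (\<xi>\<^sup>2) / (4 * w))))"
    by (rule integrable_mult_left)
  then have "integrable lborel (\<lambda>x::real. exp (- (?c * of_real x + ?z)\<^sup>2))"
    by (simp add: mult.assoc del: of_real_power)
  then show ?eq
    unfolding sq exp_add using complex_gaussian_1d[OF Re_csqrt_gt_abs_Im[OF w]] by simp
qed

text \<open>Fubini's theorem for a product of functions of the single coordinates.\<close>

lemma lborel_integral_prod:
  fixes f :: "'a::euclidean_space \<Rightarrow> real \<Rightarrow> 'b::{real_normed_field, banach, second_countable_topology}"
  assumes int: "\<And>b. b \<in> Basis \<Longrightarrow> integrable lborel (f b)"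
  shows "integrable lborel (\<lambda>x. \<Prod>b\<in>Basis. f b (x \<bullet> b))"
    and "(\<integral>x. (\<Prod>b\<in>Basis. f b (x \<bullet> b)) \<partial>lborel) = (\<Prod>b\<in>Basis. \<integral>x. f b x \<partial>lborel)"
proof -
  interpret product_sigma_finite "\<lambda>b::'a. lborel :: real measure" ..
  have [measurable]: "f b \<in> borel_measurable borel" if "b \<in> Basis" for b
    using int[OF that] by auto
  show "integrable lborel (\<lambda>x. \<Prod>b\<in>Basis. f b (x \<bullet> b))"
    by (subst lborel_eq, subst integrable_distr_eq)
       (auto simp: int intro!: product_integrable_prod)
  show "(\<integral>x. (\<Prod>b\<in>Basis. f b (x \<bullet> b)) \<partial>lborel) = (\<Prod>b\<in>Basis. \<integral>x. f b x \<partial>lborel)"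
    by (subst lborel_eq, subst integral_distr)
       (auto simp: int intro!: product_integral_prod)
qed

lemma norm_sq_eq_sum_Basis: "(norm x)\<^sup>2 = (\<Sum>b\<in>Basis. (x \<bullet> b)\<^sup>2)" for x :: "'a::euclidean_space"
  unfolding power2_norm_eq_inner by (subst euclidean_inner) (simp add: power2_eq_square)

lemma complex_gaussian_fourier:
  fixes w :: complex and \<xi> :: "'a::euclidean_space"
  assumes w: "0 < Re w"
  shows "integrable lborel (\<lambda>x::'a. exp (- w * of_real ((norm x)\<^sup>2) - \<i> * of_real (x \<bullet> \<xi>)))"
    and "(\<integral>x. exp (- w * of_real ((norm x)\<^sup>2) - \<i> * of_real (x \<bullet> \<xi>)) \<partial>lborel)
           = (of_real (sqrt pi) / csqrt w) ^ DIM('a) * exp (- of_real ((norm \<xi>)\<^sup>2) / (4 * w))"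
proof -
  have eq: "exp (- w * of_real ((norm x)\<^sup>2) - \<i> * of_real (x \<bullet> \<xi>)) =
     (\<Prod>b\<in>Basis. exp (- w * of_real ((x \<bullet> b)\<^sup>2) - \<i> * of_real ((x \<bullet> b) * (\<xi> \<bullet> b))))" for x
    unfolding norm_sq_eq_sum_Basis euclidean_inner[of x \<xi>]
    by (simp flip: exp_sum add: sum_distrib_left sum_subtractf sum_negf)
  note 1 = complex_gaussian_fourier_1d[OF w]
  show "integrable lborel (\<lambda>x::'a. exp (- w * of_real ((norm x)\<^sup>2) - \<i> * of_real (x \<bullet> \<xi>)))"
    unfolding eq by (rule lborel_integral_prod) (rule 1)
  show "(\<integral>x. exp (- w * of_real ((norm x)\<^sup>2) - \<i> * of_real (x \<bullet> \<xi>)) \<partial>lborel)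
           = (of_real (sqrt pi) / csqrt w) ^ DIM('a) * exp (- of_real ((norm \<xi>)\<^sup>2) / (4 * w))"
    unfolding eq by (subst lborel_integral_prod(2), rule 1, unfold 1(2) prod.distrib)
      (simp add: norm_sq_eq_sum_Basis sum_divide_distrib flip: exp_sum sum_negf del: of_real_power)
qed

lemma real_gaussian_integral:
  fixes a :: real
  assumes "0 < a"
  shows "integrable lborel (\<lambda>x::'a::euclidean_space. exp (- a * (norm x)\<^sup>2))"
    and "(\<integral>x. exp (- a * (norm (x::'a))\<^sup>2) \<partial>lborel) = sqrt (pi / a) ^ DIM('a)"
proof -
  have eq: "exp (- a * (norm x)\<^sup>2) = (\<Prod>b\<in>Basis. exp (- a * (x \<bullet> b)\<^sup>2))" for x :: 'a
    unfolding norm_sq_eq_sum_Basis by (simp flip: exp_sum add: sum_distrib_left sum_negf)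
  note 1 = real_gaussian_integral_1d[OF assms]
  show "integrable lborel (\<lambda>x::'a. exp (- a * (norm x)\<^sup>2))"
    unfolding eq by (rule lborel_integral_prod) (rule 1)
  show "(\<integral>x. exp (- a * (norm (x::'a))\<^sup>2) \<partial>lborel) = sqrt (pi / a) ^ DIM('a)"
    unfolding eq by (subst lborel_integral_prod(2), rule 1, unfold 1(2)) simp
qed


section \<open>The standard Gaussian is a Schwartz function\<close>

abbreviation unit_gaussian :: "'a::euclidean_space \<Rightarrow> complex" where
  "unit_gaussian \<equiv> \<lambda>x. exp (- of_real ((norm x)\<^sup>2 / 2))"

text \<open>
  The functions obtained from the standard Gaussian by multiplication with linear forms and
  scalars and by addition, that is, polynomial multiples of the Gaussian. This class is closed
  under differentiation and its members decay rapidly, so they are Schwartz functions.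
\<close>

inductive_set poly_gaussian :: "('a::euclidean_space \<Rightarrow> complex) set" where
  gaussian: "unit_gaussian \<in> poly_gaussian"
| linear: "f \<in> poly_gaussian \<Longrightarrow> (\<lambda>x. of_real (x \<bullet> v) * f x) \<in> poly_gaussian"
| scale: "f \<in> poly_gaussian \<Longrightarrow> (\<lambda>x. c * f x) \<in> poly_gaussian"
| add: "f \<in> poly_gaussian \<Longrightarrow> g \<in> poly_gaussian \<Longrightarrow> (\<lambda>x. f x + g x) \<in> poly_gaussian"

lemma poly_gaussian_has_derivative:
  assumes "f \<in> poly_gaussian"
  shows "\<exists>f'. (\<forall>x. (f has_derivative f' x) (at x)) \<and> (\<forall>v. (\<lambda>x. f' x v) \<in> poly_gaussian)"
  using assms
proof induction
  case gaussian
  have "(unit_gaussian has_derivative (\<lambda>v. - 1 * (of_real (x \<bullet> v) * unit_gaussian x))) (at x)" for x :: 'a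
  proof -
    have "((\<lambda>x::'a. - complex_of_real ((norm x)\<^sup>2 / 2)) has_derivative (\<lambda>v. - of_real (x \<bullet> v))) (at x)"
      unfolding power2_norm_eq_inner
      by (auto intro!: derivative_eq_intros simp: inner_commute fun_eq_iff)
    from has_derivative_compose[OF this DERIV_exp[unfolded has_field_derivative_def]] show ?thesis
      by (simp add: mult.commute)
  qed
  moreover have "(\<lambda>x. - 1 * (of_real (x \<bullet> v) * unit_gaussian x)) \<in> poly_gaussian" for v :: 'a
    by (intro poly_gaussian.intros)
  ultimately show ?case
    by (intro exI[of _ "\<lambda>x v. - 1 * (of_real (x \<bullet> v) * unit_gaussian x)"] conjI allI)
next
  case (linear f u)
  then obtain f' where f': "\<And>x. (f has_derivative f' x) (at x)" "\<And>v. (\<lambda>x. f' x v) \<in> poly_gaussian"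
    by blast
  have "((\<lambda>x. of_real (x \<bullet> u) * f x) has_derivative
      (\<lambda>v. of_real (x \<bullet> u) * f' x v + of_real (v \<bullet> u) * f x)) (at x)" for x
    by (auto intro!: derivative_eq_intros f')
  moreover have "(\<lambda>x. of_real (x \<bullet> u) * f' x v + of_real (v \<bullet> u) * f x) \<in> poly_gaussian" for v
    by (intro poly_gaussian.intros f' linear)
  ultimately show ?case
    by (intro exI[of _ "\<lambda>x v. of_real (x \<bullet> u) * f' x v + of_real (v \<bullet> u) * f x"] conjI allI)
next
  case (scale f c)
  then obtain f' where f': "\<And>x. (f has_derivative f' x) (at x)" "\<And>v. (\<lambda>x. f' x v) \<in> poly_gaussian"
    by blast
  have "((\<lambda>x. c * f x) has_derivative (\<lambda>v. c * f' x v)) (at x)" for x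
    by (auto intro!: derivative_eq_intros f')
  moreover have "(\<lambda>x. c * f' x v) \<in> poly_gaussian" for v
    by (intro poly_gaussian.intros f')
  ultimately show ?case
    by (intro exI[of _ "\<lambda>x v. c * f' x v"] conjI allI)
next
  case (add f g)
  then obtain f' g' where f': "\<And>x. (f has_derivative f' x) (at x)" "\<And>v. (\<lambda>x. f' x v) \<in> poly_gaussian"
    and g': "\<And>x. (g has_derivative g' x) (at x)" "\<And>v. (\<lambda>x. g' x v) \<in> poly_gaussian"
    by blast
  have "((\<lambda>x. f x + g x) has_derivative (\<lambda>v. f' x v + g' x v)) (at x)" for x
    by (intro derivative_intros f' g')
  moreover have "(\<lambda>x. f' x v + g' x v) \<in> poly_gaussian" for v
    by (intro poly_gaussian.intros f' g')
  ultimately show ?case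
    by (intro exI[of _ "\<lambda>x v. f' x v + g' x v"] conjI allI)
qed

lemma poly_gaussian_rapid_decay:
  assumes "f \<in> poly_gaussian"
  shows "\<exists>B. \<forall>x. (1 + norm x) ^ k * norm (f x) \<le> B"
  using assms
proof (induction arbitrary: k)
  case gaussian
  have "(1 + norm x) ^ k * norm (unit_gaussian x) \<le> exp ((real k)\<^sup>2 / 2)" for x :: 'a
  proof -
    have "(1 + norm x) ^ k \<le> exp (norm x) ^ k"
      by (intro power_mono) auto
    then have "(1 + norm x) ^ k * norm (unit_gaussian x) \<le> exp (real k * norm x) * exp (- ((norm x)\<^sup>2 / 2))"
      by (simp add: exp_of_nat_mult)
    \<comment> \<open>Completing the square in \<open>k r - r\<^sup>2 / 2\<close> with \<open>r = norm x\<close>.\<close>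
    also have "\<dots> = exp ((real k)\<^sup>2 / 2 - (norm x - real k)\<^sup>2 / 2)"
      unfolding exp_add[symmetric] by (simp add: power2_eq_square algebra_simps diff_divide_distrib add_divide_distrib)
    also have "\<dots> \<le> exp ((real k)\<^sup>2 / 2)" by simp
    finally show ?thesis .
  qed
  then show ?case by blast
next
  case (linear f v)
  then obtain B where B: "\<And>x. (1 + norm x) ^ Suc k * norm (f x) \<le> B" by blast
  have "(1 + norm x) ^ k * norm (of_real (x \<bullet> v) * f x) \<le> norm v * B" for x
  proof -
    have "\<bar>x \<bullet> v\<bar> \<le> (1 + norm x) * norm v"
      using Cauchy_Schwarz_ineq2[of x v] norm_ge_zero[of v] unfolding distrib_right by linarith
    then have "(1 + norm x) ^ k * norm (of_real (x \<bullet> v) * f x)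
        \<le> (1 + norm x) ^ k * (((1 + norm x) * norm v) * norm (f x))"
      unfolding norm_mult norm_of_real by (intro mult_left_mono mult_right_mono) auto
    also have "\<dots> = norm v * ((1 + norm x) ^ Suc k * norm (f x))" by simp
    also have "\<dots> \<le> norm v * B" using B by (intro mult_left_mono) auto
    finally show ?thesis .
  qed
  then show ?case by blast
next
  case (scale f c)
  then obtain B where B: "\<And>x. (1 + norm x) ^ k * norm (f x) \<le> B" by blast
  have "(1 + norm x) ^ k * norm (c * f x) \<le> norm c * B" for x
    using mult_left_mono[OF B[of x], of "norm c"] by (simp add: norm_mult algebra_simps)
  then show ?case by blast
next
  case (add f g)
  then obtain B C where B: "\<And>x. (1 + norm x) ^ k * norm (f x) \<le> B"
    and C: "\<And>x. (1 + norm x) ^ k * norm (g x) \<le> C" by metis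
  have "(1 + norm x) ^ k * norm (f x + g x) \<le> B + C" for x
  proof -
    have "(1 + norm x) ^ k * norm (f x + g x) \<le> (1 + norm x) ^ k * (norm (f x) + norm (g x))"
      by (intro mult_left_mono norm_triangle_ineq) auto
    then show ?thesis using B[of x] C[of x] by (simp add: algebra_simps)
  qed
  then show ?case by blast
qed

lemma partial_deriv_poly_gaussian:
  assumes "f \<in> poly_gaussian"
  shows "partial_deriv b f \<in> poly_gaussian"
proof -
  obtain f' where f': "\<And>x. (f has_derivative f' x) (at x)" "\<And>v. (\<lambda>x. f' x v) \<in> poly_gaussian"
    using poly_gaussian_has_derivative[OF assms] by blast
  have "partial_deriv b f = (\<lambda>x. f' x b)"
    unfolding partial_deriv_def using frechet_derivative_at[OF f'(1)] by metis
  then show ?thesis using f' by simp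
qed

lemma poly_gaussian_subset_schwartz: "poly_gaussian \<subseteq> schwartz"
proof
  fix f :: "'a \<Rightarrow> complex" assume f: "f \<in> poly_gaussian"
  have iter: "foldr partial_deriv bs f \<in> poly_gaussian" for bs
    using f by (induction bs) (auto intro: partial_deriv_poly_gaussian)
  show "f \<in> schwartz"
    unfolding schwartz_def mem_Collect_eq
  proof (intro ballI conjI allI)
    fix bs k and x :: 'a
    show "foldr partial_deriv bs f differentiable at x"
      using poly_gaussian_has_derivative[OF iter] by (metis differentiable_def)
    show "bounded (range (\<lambda>x. (1 + norm x) ^ k *\<^sub>R foldr partial_deriv bs f x))"
      using poly_gaussian_rapid_decay[OF iter, of k bs] by (auto simp: bounded_iff)
  qed
qed

lemma unit_gaussian_schwartz: "unit_gaussian \<in> schwartz"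
  using poly_gaussian.gaussian poly_gaussian_subset_schwartz by blast


section \<open>Lower bounds for Lebesgue and mixed norms\<close>

lemma ennpowr_mono: "x \<le> y \<Longrightarrow> 0 \<le> a \<Longrightarrow> ennpowr x a \<le> ennpowr y a"
  unfolding ennpowr_def
  by (auto simp: top_unique less_top intro!: ennreal_leI powr_mono2 enn2real_mono)

lemma ennpowr_ennreal: "0 \<le> x \<Longrightarrow> ennpowr (ennreal x) a = ennreal (x powr a)"
  by (simp add: ennpowr_def)

lemma enn2real_ge_1:
  assumes "1 \<le> p" "p \<noteq> (\<infinity>::ennreal)"
  shows "1 \<le> enn2real p"
  using enn2real_mono[OF assms(1)] assms(2) by (simp add: less_top)

text \<open>
  No measurability of \<open>h\<close> is needed: the nonnegative integral is monotone without it, and the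
  essential supremum of a nonmeasurable function is \<open>\<infinity>\<close> by definition.
\<close>

lemma Lp_ennnorm_ge_interval:
  fixes \<delta> a :: real
  assumes p: "1 \<le> p" and \<delta>: "0 < \<delta>"
    and h: "\<And>t. a \<le> t \<Longrightarrow> t \<le> a + 1 \<Longrightarrow> ennreal \<delta> \<le> h t"
  shows "ennreal \<delta> \<le> Lp_ennnorm p lborel h"
proof (cases "p = \<infinity>")
  case True
  show ?thesis
  proof (rule ccontr)
    assume "\<not> ?thesis"
    then have "esssup lborel h < ennreal \<delta>" using True by (simp add: Lp_ennnorm_def)
    then have "AE t in lborel. t \<notin> {a..a+1}"
      by (intro eventually_mono[OF esssup_AE[of h lborel]]) (use h in \<open>force simp: not_le[symmetric]\<close>)
    then have "emeasure lborel {a..a+1} = 0"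
      by (subst (asm) AE_iff_measurable[OF _ refl]) (auto simp: Collect_conj_eq atLeastAtMost_def atLeast_def atMost_def)
    then show False by simp
  qed
next
  case False
  define \<kappa> where "\<kappa> = enn2real p"
  have \<kappa>: "1 \<le> \<kappa>" unfolding \<kappa>_def by (rule enn2real_ge_1[OF p False])
  have "ennreal (\<delta> powr \<kappa>) = (\<integral>\<^sup>+ t. ennreal (\<delta> powr \<kappa>) * indicator {a..a+1} t \<partial>lborel)"
    by (subst nn_integral_cmult_indicator) simp_all
  also have "\<dots> \<le> (\<integral>\<^sup>+ t. ennpowr (h t) \<kappa> \<partial>lborel)"
  proof (intro nn_integral_mono)
    fix t
    show "ennreal (\<delta> powr \<kappa>) * indicator {a..a+1} t \<le> ennpowr (h t) \<kappa>"
      using ennpowr_mono[OF h[of t], of \<kappa>] \<kappa> \<delta> by (auto simp: ennpowr_ennreal split: split_indicator)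
  qed
  finally have "ennpowr (ennreal (\<delta> powr \<kappa>)) (1 / \<kappa>) \<le> ennpowr (\<integral>\<^sup>+ t. ennpowr (h t) \<kappa> \<partial>lborel) (1 / \<kappa>)"
    using \<kappa> by (intro ennpowr_mono) auto
  then show ?thesis
    using \<kappa> \<delta> False by (simp add: Lp_ennnorm_def ennpowr_ennreal powr_powr \<kappa>_def)
qed

text \<open>
  This pointwise inequality replaces Hoelder's inequality below; it only needs a test function
  that is bounded and integrable, and it includes the exponent \<open>1\<close>.
\<close>

lemma le_eps_add_powr:
  fixes y \<epsilon> \<kappa> :: real
  assumes "0 \<le> y" "0 < \<epsilon>" "1 \<le> \<kappa>"
  shows "y \<le> \<epsilon> + \<epsilon> powr (1 - \<kappa>) * y powr \<kappa>"
proof (cases "y \<le> \<epsilon>")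
  case False
  then have "y = y powr (1 - \<kappa>) * y powr \<kappa>"
    using assms by (simp flip: powr_add)
  also have "\<dots> \<le> \<epsilon> powr (1 - \<kappa>) * y powr \<kappa>"
    using assms False by (intro mult_right_mono powr_mono2') auto
  finally show ?thesis using assms by simp
qed (use assms in \<open>simp add: add_increasing2\<close>)

lemma Lp_norm_ge_of_pairing:
  fixes \<phi> :: "'a::euclidean_space \<Rightarrow> complex"
  assumes \<phi>: "integrable lborel \<phi>" "\<And>x. norm (\<phi> x) \<le> 1" and q: "1 \<le> q" and c: "0 < c"
  obtains \<delta> :: real where "0 < \<delta>"
    "\<And>g. g \<in> Lp_space q \<Longrightarrow> c \<le> norm (distr_of g \<phi>) \<Longrightarrow> ennreal \<delta> \<le> Lp_norm q g"
proof -
  \<comment> \<open>The summand \<open>1\<close> ensures that \<open>M\<close> is positive even if \<open>\<phi>\<close> vanishes.\<close>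
  define M where "M = (\<integral>x. norm (\<phi> x) \<partial>lborel) + 1"
  have M: "0 < M" unfolding M_def by (intro add_nonneg_pos integral_nonneg) auto
  have \<phi>M: "(\<integral>\<^sup>+x. ennreal (norm (\<phi> x)) \<partial>lborel) \<le> ennreal M"
    using \<phi>(1) by (subst nn_integral_eq_integral) (auto simp: M_def intro!: ennreal_leI)
  have [measurable]: "\<phi> \<in> borel_measurable borel" using \<phi> by auto
  have pair: "ennreal c \<le> (\<integral>\<^sup>+x. ennreal (norm (g x)) * ennreal (norm (\<phi> x)) \<partial>lborel)"
    if g: "c \<le> norm (distr_of g \<phi>)" for g
  proof -
    have "integrable lborel (\<lambda>x. g x * \<phi> x)"
    proof (rule ccontr)
      assume "\<not> ?thesis"
      \<comment> \<open>The Bochner integral of a nonintegrable function is \<open>0\<close>.\<close>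
      then show False using g c by (simp add: distr_of_def not_integrable_integral_eq)
    qed
    then have "ennreal (norm (distr_of g \<phi>)) \<le> (\<integral>\<^sup>+x. ennreal (norm (g x * \<phi> x)) \<partial>lborel)"
      unfolding distr_of_def by (rule integral_norm_bound_ennreal)
    with g show ?thesis
      by (auto simp: norm_mult ennreal_mult intro: order_trans ennreal_leI)
  qed
  show ?thesis
  proof (cases "q = \<infinity>")
    case True
    have "ennreal (c / M) \<le> Lp_norm q g" if g: "g \<in> Lp_space q" "c \<le> norm (distr_of g \<phi>)" for g
    proof -
      let ?N = "esssup lborel (\<lambda>x. ennreal (norm (g x)))"
      have N: "Lp_norm q g = ?N" by (simp add: Lp_norm_def Lp_ennnorm_def True)
      then obtain n where n: "?N = ennreal n" "0 \<le> n"
        using g by (cases ?N) (auto simp: Lp_space_def)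
      have "ennreal c \<le> (\<integral>\<^sup>+x. ?N * ennreal (norm (\<phi> x)) \<partial>lborel)"
        using esssup_AE[of "\<lambda>x. ennreal (norm (g x))" lborel]
        by (intro order_trans[OF pair[OF g(2)]] nn_integral_mono_AE)
           (auto elim!: eventually_mono intro!: mult_right_mono)
      also have "\<dots> = ?N * (\<integral>\<^sup>+x. ennreal (norm (\<phi> x)) \<partial>lborel)"
        by (rule nn_integral_cmult) simp
      also have "\<dots> \<le> ennreal n * ennreal M"
        unfolding n by (intro mult_left_mono \<phi>M) auto
      finally have "c \<le> n * M"
        using n M by (simp add: ennreal_mult[symmetric] ennreal_le_iff)
      then show ?thesis
        unfolding N n using M by (intro ennreal_leI) (simp add: field_simps)
    qed
    then show ?thesis using that[of "c / M"] c M by auto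
  next
    case False
    define \<kappa> where "\<kappa> = enn2real q"
    have \<kappa>: "1 \<le> \<kappa>" unfolding \<kappa>_def by (rule enn2real_ge_1[OF q False])
    \<comment> \<open>This choice makes the contribution \<open>\<epsilon> * M\<close> of the test function equal to \<open>c / 2\<close>.\<close>
    define \<epsilon> where "\<epsilon> = c / (2 * M)"
    have \<epsilon>: "0 < \<epsilon>" using c M by (simp add: \<epsilon>_def)
    define \<eta> where "\<eta> = c / 2 * \<epsilon> powr (\<kappa> - 1)"
    have \<eta>: "0 < \<eta>" using c \<epsilon> by (simp add: \<eta>_def)
    have "ennreal (\<eta> powr (1 / \<kappa>)) \<le> Lp_norm q g"
      if g: "g \<in> Lp_space q" "c \<le> norm (distr_of g \<phi>)" for g
    proof -
      have [measurable]: "g \<in> borel_measurable borel" using g by (simp add: Lp_space_def)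
      let ?I = "\<integral>\<^sup>+x. ennreal (norm (g x) powr \<kappa>) \<partial>lborel"
      have N: "Lp_norm q g = ennpowr ?I (1 / \<kappa>)"
        using False by (simp add: Lp_norm_def Lp_ennnorm_def \<kappa>_def ennpowr_ennreal)
      have "ennreal \<eta> \<le> ?I"
      proof (cases ?I)
        case (real i)
        have "ennreal c \<le> (\<integral>\<^sup>+x. ennreal \<epsilon> * ennreal (norm (\<phi> x)) +
            ennreal (\<epsilon> powr (1 - \<kappa>)) * ennreal (norm (g x) powr \<kappa>) \<partial>lborel)"
        proof (intro order_trans[OF pair[OF g(2)]] nn_integral_mono)
          fix x
          have "norm (g x) * norm (\<phi> x)
              \<le> (\<epsilon> + \<epsilon> powr (1 - \<kappa>) * norm (g x) powr \<kappa>) * norm (\<phi> x)"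
            using \<epsilon> \<kappa> by (intro mult_right_mono le_eps_add_powr) auto
          also have "\<dots> \<le> \<epsilon> * norm (\<phi> x) + \<epsilon> powr (1 - \<kappa>) * norm (g x) powr \<kappa>"
            using \<phi>(2)[of x] by (simp add: distrib_right mult_left_le)
          finally show "ennreal (norm (g x)) * ennreal (norm (\<phi> x)) \<le> ennreal \<epsilon> * ennreal (norm (\<phi> x)) +
              ennreal (\<epsilon> powr (1 - \<kappa>)) * ennreal (norm (g x) powr \<kappa>)"
            using \<epsilon> by (simp add: ennreal_mult[symmetric] ennreal_plus[symmetric] ennreal_leI del: ennreal_plus)
        qed
        also have "\<dots> = ennreal \<epsilon> * (\<integral>\<^sup>+x. ennreal (norm (\<phi> x)) \<partial>lborel) + ennreal (\<epsilon> powr (1 - \<kappa>)) * ?I"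
          by (simp add: nn_integral_add nn_integral_cmult)
        also have "\<dots> \<le> ennreal \<epsilon> * ennreal M + ennreal (\<epsilon> powr (1 - \<kappa>)) * ennreal i"
          unfolding real by (intro add_mono mult_left_mono \<phi>M) auto
        also have "\<dots> = ennreal (\<epsilon> * M + \<epsilon> powr (1 - \<kappa>) * i)"
          using \<epsilon> M real by (simp add: ennreal_mult[symmetric] ennreal_plus[symmetric] del: ennreal_plus)
        finally have "c \<le> \<epsilon> * M + \<epsilon> powr (1 - \<kappa>) * i"
          using \<epsilon> M real by (subst (asm) ennreal_le_iff) auto
        then have "c / 2 \<le> \<epsilon> powr (1 - \<kappa>) * i"
          using M by (simp add: \<epsilon>_def)
        then have "c / 2 * \<epsilon> powr (\<kappa> - 1) \<le> \<epsilon> powr (1 - \<kappa>) * i * \<epsilon> powr (\<kappa> - 1)"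
          by (intro mult_right_mono) auto
        also have "\<dots> = (\<epsilon> powr (1 - \<kappa>) * \<epsilon> powr (\<kappa> - 1)) * i" by simp
        also have "\<epsilon> powr (1 - \<kappa>) * \<epsilon> powr (\<kappa> - 1) = 1"
          using \<epsilon> by (simp flip: powr_add)
        finally show ?thesis unfolding real \<eta>_def by (intro ennreal_leI) simp
      qed simp
      then have "ennpowr (ennreal \<eta>) (1 / \<kappa>) \<le> Lp_norm q g"
        unfolding N using \<kappa> by (intro ennpowr_mono) auto
      then show ?thesis using \<eta> by (simp add: ennpowr_ennreal)
    qed
    then show ?thesis using that[of "\<eta> powr (1 / \<kappa>)"] \<eta> by auto
  qed
qed

lemma Lp_norm_distr_geI:
  assumes "\<phi> \<in> schwartz" and "\<And>g. g \<in> Lp_space q \<Longrightarrow> distr_of g \<phi> = T \<phi> \<Longrightarrow> \<delta> \<le> Lp_norm q g"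
  shows "\<delta> \<le> Lp_norm_distr q T"
  unfolding Lp_norm_distr_def using assms by (intro Inf_greatest) auto

section \<open>Focusing Gaussian data\<close>

lemma Re_inverse_pos: "0 < Re z \<Longrightarrow> 0 < Re (inverse z)"
  by (simp add: sum_power2_gt_zero_iff)

text \<open>
  Up to a constant of modulus one, \<open>chirp T\<close> is \<open>U(-T)\<close> applied to the standard Gaussian
  \<open>exp (- \<bar>x\<bar>\<^sup>2 / 2)\<close>; the power of \<open>1 + 4 T\<^sup>2\<close> is the modulus of the amplitude
  \<open>(1 - 2 i T)\<^bsup>- d / 2\<^esup>\<close>.
\<close>

definition chirp :: "real \<Rightarrow> 'a::euclidean_space \<Rightarrow> complex" where
  "chirp T x = of_real (((1 + 4 * T\<^sup>2) powr (- 1 / 4)) ^ DIM('a)) *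
     exp (- inverse (2 * (1 - 2 * \<i> * of_real T)) * of_real ((norm x)\<^sup>2))"

lemma Re_chirp_exponent: "Re (inverse (2 * (1 - 2 * \<i> * of_real T))) = 1 / (2 * (1 + 4 * T\<^sup>2))"
  unfolding inverse_complex.simps by (simp add: power2_eq_square field_simps add_nonneg_eq_0_iff)

lemma norm_chirp:
  "norm (chirp T (x :: 'a::euclidean_space)) =
    ((1 + 4 * T\<^sup>2) powr (- 1 / 4)) ^ DIM('a) * exp (- (1 / (2 * (1 + 4 * T\<^sup>2))) * (norm x)\<^sup>2)"
  unfolding chirp_def norm_mult norm_exp_eq_Re norm_of_real Re_chirp_exponent[symmetric]
  by (simp del: inverse_mult_distrib)

lemma borel_measurable_chirp [measurable]: "chirp T \<in> borel_measurable borel"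
  unfolding chirp_def by measurable

lemma inv_fourier_unit_gaussian:
  fixes \<xi> :: "'a::euclidean_space"
  shows "inv_fourier unit_gaussian \<xi> = of_real (1 / (2 * pi) ^ DIM('a)) *
    (of_real (sqrt pi) / csqrt (1 / 2)) ^ DIM('a) * unit_gaussian \<xi>"
proof -
  have "inv_fourier unit_gaussian \<xi> = of_real (1 / (2 * pi) ^ DIM('a)) *
     (\<integral>x. exp (- (1 / 2) * of_real ((norm x)\<^sup>2) - \<i> * of_real (x \<bullet> - \<xi>)) \<partial>lborel)"
    unfolding inv_fourier_def exp_add[symmetric] by (simp add: inner_commute algebra_simps)
  also have "(\<integral>x. exp (- (1 / 2) * of_real ((norm x)\<^sup>2) - \<i> * of_real (x \<bullet> - \<xi>)) \<partial>lborel)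
      = (of_real (sqrt pi) / csqrt (1 / 2)) ^ DIM('a) * exp (- of_real ((norm (- \<xi>))\<^sup>2) / (4 * (1 / 2)))"
    by (rule complex_gaussian_fourier) simp
  finally show ?thesis by simp
qed

text \<open>
  By transposition, the multiplier \<open>exp (- i t \<bar>\<xi>\<bar>\<^sup>2)\<close> acts on the test function. It turns the Gaussian
  with exponent \<open>1 / 2\<close> into the one with exponent \<open>w\<close>, and \<open>v\<close> is the sum of the exponents of the
  chirp and of the Fourier transform of the latter.
\<close>

lemma schrodinger_chirp_unit_gaussian:
  fixes T t :: real
  defines "w \<equiv> 1 / 2 + \<i> * of_real t"
  defines "v \<equiv> inverse (2 * (1 - 2 * \<i> * of_real T)) + inverse (4 * w)"
  shows "schrodinger t (distr_of (chirp T :: 'a::euclidean_space \<Rightarrow> complex)) unit_gaussian =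
    of_real (1 / (2 * pi) ^ DIM('a)) * (of_real (sqrt pi) / csqrt (1 / 2)) ^ DIM('a) *
    of_real (((1 + 4 * T\<^sup>2) powr (- 1 / 4)) ^ DIM('a)) *
    (of_real (sqrt pi) / csqrt w) ^ DIM('a) * (of_real (sqrt pi) / csqrt v) ^ DIM('a)"
proof -
  define K :: complex where "K = of_real (1 / (2 * pi) ^ DIM('a)) * (of_real (sqrt pi) / csqrt (1 / 2)) ^ DIM('a)"
  define A :: complex where "A = of_real (((1 + 4 * T\<^sup>2) powr (- 1 / 4)) ^ DIM('a))"
  define P where "P = (of_real (sqrt pi) / csqrt w) ^ DIM('a)"
  have w: "0 < Re w" by (simp add: w_def)
  have v: "0 < Re v"
    unfolding v_def plus_complex.sel using w by (intro add_pos_pos Re_inverse_pos) auto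
  have "fourier (\<lambda>\<xi>. exp (- \<i> * of_real (t * (norm \<xi>)\<^sup>2)) * inv_fourier unit_gaussian \<xi>) x =
      K * P * exp (- inverse (4 * w) * of_real ((norm x)\<^sup>2))" for x :: 'a
  proof -
    have "fourier (\<lambda>\<xi>. exp (- \<i> * of_real (t * (norm \<xi>)\<^sup>2)) * inv_fourier unit_gaussian \<xi>) x =
        (\<integral>\<xi>. K * exp (- w * of_real ((norm \<xi>)\<^sup>2) - \<i> * of_real (\<xi> \<bullet> x)) \<partial>lborel)"
      unfolding fourier_def inv_fourier_unit_gaussian K_def[symmetric]
    proof (intro Bochner_Integration.integral_cong refl)
      fix \<xi> :: 'a
      have "exp (- w * of_real ((norm \<xi>)\<^sup>2) - \<i> * of_real (\<xi> \<bullet> x)) =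
          exp (- \<i> * of_real (\<xi> \<bullet> x)) * (exp (- \<i> * of_real (t * (norm \<xi>)\<^sup>2)) * unit_gaussian \<xi>)"
        unfolding exp_add[symmetric] w_def
        by (rule arg_cong[where f = exp]) (simp add: algebra_simps)
      then show "exp (- \<i> * of_real (\<xi> \<bullet> x)) * (exp (- \<i> * of_real (t * (norm \<xi>)\<^sup>2)) * (K * unit_gaussian \<xi>))
          = K * exp (- w * of_real ((norm \<xi>)\<^sup>2) - \<i> * of_real (\<xi> \<bullet> x))"
        by (simp only: mult.left_commute)
    qed
    also have "\<dots> = K * (P * exp (- of_real ((norm x)\<^sup>2) / (4 * w)))"
      unfolding P_def complex_gaussian_fourier(2)[OF w, symmetric] by (rule integral_mult_right_zero)
    also have "- of_real ((norm x)\<^sup>2) / (4 * w) = - inverse (4 * w) * of_real ((norm x)\<^sup>2)"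
      by (simp only: divide_inverse mult_minus_left mult_minus_right mult.commute)
    finally show ?thesis by (simp only: mult.assoc)
  qed
  then have "schrodinger t (distr_of (chirp T)) (unit_gaussian :: 'a \<Rightarrow> complex) =
      (\<integral>x. chirp T x * (K * P * exp (- inverse (4 * w) * of_real ((norm (x::'a))\<^sup>2))) \<partial>lborel)"
    by (simp add: schrodinger_def inv_fourier_distr_def mult_distr_def fourier_distr_def distr_of_def)
  also have "\<dots> = (\<integral>x. (K * A * P) * exp (- v * of_real ((norm (x::'a))\<^sup>2) - \<i> * of_real (x \<bullet> 0)) \<partial>lborel)"
  proof (intro Bochner_Integration.integral_cong refl)
    fix x :: 'a
    have "exp (- v * of_real ((norm x)\<^sup>2) - \<i> * of_real (x \<bullet> 0)) =
        exp (- inverse (2 * (1 - 2 * \<i> * of_real T)) * of_real ((norm x)\<^sup>2)) *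
        exp (- inverse (4 * w) * of_real ((norm x)\<^sup>2))"
      unfolding exp_add[symmetric] v_def
      by (rule arg_cong[where f = exp]) (simp add: algebra_simps)
    then show "chirp T x * (K * P * exp (- inverse (4 * w) * of_real ((norm x)\<^sup>2)))
        = (K * A * P) * exp (- v * of_real ((norm x)\<^sup>2) - \<i> * of_real (x \<bullet> 0))"
      unfolding chirp_def A_def[symmetric] by (simp only: mult_ac)
  qed
  also have "\<dots> = (K * A * P) * ((of_real (sqrt pi) / csqrt v) ^ DIM('a) * exp (- of_real ((norm (0::'a))\<^sup>2) / (4 * v)))"
    unfolding complex_gaussian_fourier(2)[OF v, symmetric] by (rule integral_mult_right_zero)
  finally show ?thesis by (simp add: K_def A_def P_def mult.assoc)
qed

text \<open>
  The moduli of all factors are explicit; the bound comes from \<open>\<bar>w v\<bar> \<le> (1 + 4 T\<^sup>2)\<^bsup>- 1 / 2\<^esup>\<close> near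
  \<open>t = T\<close>, which is compensated exactly by the amplitude of the chirp.
\<close>

lemma norm_schrodinger_chirp_ge:
  fixes T t :: real
  assumes t: "\<bar>t - T\<bar> \<le> 1"
  shows "(1 / (2 * pi) ^ DIM('a)) * (sqrt pi / sqrt (1 / 2)) ^ DIM('a) * pi ^ DIM('a)
    \<le> norm (schrodinger t (distr_of (chirp T :: 'a::euclidean_space \<Rightarrow> complex)) unit_gaussian)"
proof -
  define S where "S = 1 + 4 * T\<^sup>2"
  define w where "w = 1 / 2 + \<i> * of_real t"
  define u where "u = 1 - 2 * \<i> * of_real T"
  define v where "v = inverse (2 * u) + inverse (4 * w)"
  define s where "s = 1 + \<i> * of_real (t - T)"
  have S: "1 \<le> S" by (simp add: S_def)
  have u: "u \<noteq> 0" by (auto simp: u_def complex_eq_iff)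
  have w: "w \<noteq> 0" by (auto simp: w_def complex_eq_iff)
  have norm_u: "norm u = sqrt S"
    by (simp add: u_def S_def cmod_def power2_eq_square)
  have "w * v = (2 * w + u) / (4 * u)"
    unfolding v_def using u w by (simp add: field_simps)
  also have "2 * w + u = 2 * s"
    by (simp add: w_def u_def s_def algebra_simps)
  finally have "norm (w * v) = norm s / (2 * sqrt S)"
    by (simp add: norm_divide norm_mult norm_u)
  also have "\<dots> \<le> 2 / (2 * sqrt S)"
  proof (rule divide_right_mono)
    have "norm s \<le> 1 + \<bar>t - T\<bar>"
      unfolding s_def by (rule order_trans[OF norm_triangle_ineq]) (simp add: norm_mult flip: of_real_diff)
    then show "norm s \<le> 2" using t by simp
  qed (use S in simp)
  finally have "norm (w * v) \<le> 1 / sqrt S"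
    by simp
  moreover have v: "0 < Re v"
    unfolding v_def plus_complex.sel by (intro add_pos_pos Re_inverse_pos) (auto simp: u_def w_def)
  ultimately have "sqrt (norm w * norm v) \<le> sqrt (1 / sqrt S)"
    by (simp add: norm_mult)
  also have "sqrt (1 / sqrt S) = S powr (- 1 / 4)"
    using S by (simp add: powr_minus_divide real_sqrt_divide powr_half_sqrt[symmetric] powr_powr)
  finally have le: "sqrt (norm w) * sqrt (norm v) \<le> S powr (- 1 / 4)"
    by (simp add: real_sqrt_mult)
  have "0 < norm v" using v by auto
  then have pos: "0 < sqrt (norm w) * sqrt (norm v)" using w by simp
  have "pi \<le> S powr (- 1 / 4) * (sqrt pi / sqrt (norm w)) * (sqrt pi / sqrt (norm v))"
  proof -
    have "pi * 1 \<le> pi * (S powr (- 1 / 4) / (sqrt (norm w) * sqrt (norm v)))"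
      using le pos by (intro mult_left_mono) (simp_all add: le_divide_eq)
    moreover have "(y * y) * (x / (a * b)) = x * (y / a) * (y / b)" for x y a b :: real
      by simp
    from this[of "sqrt pi"]
    have "pi * (S powr (- 1 / 4) / (sqrt (norm w) * sqrt (norm v)))
        = S powr (- 1 / 4) * (sqrt pi / sqrt (norm w)) * (sqrt pi / sqrt (norm v))"
      by simp
    ultimately show ?thesis by (simp only: mult_1_right)
  qed
  then have "pi ^ DIM('a) \<le> (S powr (- 1 / 4) * (sqrt pi / sqrt (norm w)) * (sqrt pi / sqrt (norm v))) ^ DIM('a)"
    by (intro power_mono) auto
  then have "(1 / (2 * pi) ^ DIM('a)) * (sqrt pi / sqrt (1 / 2)) ^ DIM('a) * pi ^ DIM('a) \<le>
    (1 / (2 * pi) ^ DIM('a)) * (sqrt pi / sqrt (1 / 2)) ^ DIM('a) *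
    (S powr (- 1 / 4) * (sqrt pi / sqrt (norm w)) * (sqrt pi / sqrt (norm v))) ^ DIM('a)"
    by (intro mult_left_mono) auto
  also have "\<dots> = norm (schrodinger t (distr_of (chirp T :: 'a \<Rightarrow> complex)) unit_gaussian)"
    unfolding schrodinger_chirp_unit_gaussian u_def[symmetric] w_def[symmetric] v_def[symmetric] S_def[symmetric]
    by (simp add: norm_mult norm_divide norm_power power_mult_distrib power_divide del: csqrt.simps inverse_mult_distrib)
  finally show ?thesis .
qed

lemma mixed_norm_chirp_ge:
  assumes p: "1 \<le> p" and q: "1 \<le> q"
  obtains \<delta> :: real where "0 < \<delta>"
    "\<And>T. ennreal \<delta> \<le> mixed_norm p q (\<lambda>t. schrodinger t (distr_of (chirp T :: 'a::euclidean_space \<Rightarrow> complex)))"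
proof -
  define c where "c = (1 / (2 * pi) ^ DIM('a)) * (sqrt pi / sqrt (1 / 2)) ^ DIM('a) * pi ^ DIM('a)"
  have c: "0 < c" by (simp add: c_def)
  have int: "integrable lborel (unit_gaussian :: 'a \<Rightarrow> complex)"
    using complex_gaussian_fourier(1)[of "1 / 2" "0 :: 'a"] by simp
  have bd: "norm (unit_gaussian x) \<le> 1" for x :: 'a by simp
  obtain \<delta> :: real where \<delta>: "0 < \<delta>"
    and g: "\<And>g :: 'a \<Rightarrow> complex. g \<in> Lp_space q \<Longrightarrow> c \<le> norm (distr_of g unit_gaussian) \<Longrightarrow> ennreal \<delta> \<le> Lp_norm q g"
    by (rule Lp_norm_ge_of_pairing[OF int bd q c]) blast
  have "ennreal \<delta> \<le> mixed_norm p q (\<lambda>t. schrodinger t (distr_of (chirp T :: 'a \<Rightarrow> complex)))" for T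
    unfolding mixed_norm_def
  proof (rule Lp_ennnorm_ge_interval[OF p \<delta>, of T])
    fix t assume "T \<le> t" "t \<le> T + 1"
    then have "c \<le> norm (schrodinger t (distr_of (chirp T :: 'a \<Rightarrow> complex)) unit_gaussian)"
      unfolding c_def by (intro norm_schrodinger_chirp_ge) auto
    then show "ennreal \<delta> \<le> Lp_norm_distr q (schrodinger t (distr_of (chirp T :: 'a \<Rightarrow> complex)))"
      by (intro Lp_norm_distr_geI[OF unit_gaussian_schwartz] g) auto
  qed
  with \<delta> that show ?thesis by blast
qed

text \<open>
  The modulus of the chirp is a real Gaussian of height \<open>S\<^bsup>- d / 4\<^esup>\<close> and width of order \<open>S\<^bsup>1 / 2\<^esup>\<close>,
  where \<open>S = 1 + 4 T\<^sup>2\<close>. For finite \<open>r\<close> the integral of its \<open>r\<close>-th power is a constant times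
  \<open>S\<^bsup>d (1 / 2 - r / 4)\<^esup>\<close>, and the exponent is negative exactly because \<open>r > 2\<close>.
\<close>

lemma Lp_norm_chirp_tendsto_0:
  assumes r: "2 < r"
  obtains N :: "real \<Rightarrow> real" where "(N \<longlongrightarrow> 0) at_top" and "\<And>T. 0 \<le> N T"
    and "\<And>T. Lp_norm r (chirp T :: 'a::euclidean_space \<Rightarrow> complex) \<le> ennreal (N T)"
proof (cases "r = \<infinity>")
  case True
  define N where "N T = ((1 + 4 * T\<^sup>2) powr (- 1 / 4)) ^ DIM('a)" for T :: real
  have "((\<lambda>T::real. (1 + 4 * T\<^sup>2) powr (- 1 / 4)) \<longlongrightarrow> 0) at_top"
    by real_asymp
  then have "(N \<longlongrightarrow> 0) at_top"
    unfolding N_def by (auto intro!: tendsto_eq_intros simp: power_0_left)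
  moreover have "Lp_norm r (chirp T :: 'a \<Rightarrow> complex) \<le> ennreal (N T)" for T
    unfolding Lp_norm_def Lp_ennnorm_def if_P[OF True]
    by (rule esssup_I) (auto intro!: ennreal_leI mult_left_le simp: norm_chirp N_def)
  ultimately show ?thesis by (intro that[of N]) (auto simp: N_def)
next
  case False
  define \<rho> where "\<rho> = enn2real r"
  have r_eq: "r = ennreal \<rho>" using False by (simp add: \<rho>_def less_top)
  have \<rho>: "2 < \<rho>"
    using r unfolding r_eq by (metis ennreal_numeral ennreal_less_iff zero_le_numeral)
  define N where "N T = ((sqrt (2 * pi / \<rho>) * (1 + 4 * T\<^sup>2) powr (1 / 2 - \<rho> / 4)) ^ DIM('a)) powr (1 / \<rho>)" for T
  have "((\<lambda>T::real. (1 + 4 * T\<^sup>2) powr (1 / 2 - \<rho> / 4)) \<longlongrightarrow> 0) at_top"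
  proof (rule tendsto_neg_powr)
    show "filterlim (\<lambda>T::real. 1 + 4 * T\<^sup>2) at_top at_top" by real_asymp
  qed (use \<rho> in simp)
  from tendsto_power[OF tendsto_mult_left[OF this, of "sqrt (2 * pi / \<rho>)"], of "DIM('a)"]
  have "((\<lambda>T. (sqrt (2 * pi / \<rho>) * (1 + 4 * T\<^sup>2) powr (1 / 2 - \<rho> / 4)) ^ DIM('a)) \<longlongrightarrow> 0) at_top"
    by (simp add: power_0_left)
  then have "(N \<longlongrightarrow> 0) at_top"
    unfolding N_def using \<rho> by (intro tendsto_zero_powrI[where b = "1 / \<rho>"]) auto
  moreover have "Lp_norm r (chirp T :: 'a \<Rightarrow> complex) = ennreal (N T)" for T
  proof -
    define S where "S = 1 + 4 * T\<^sup>2"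
    define a where "a = \<rho> / (2 * S)"
    have S: "1 \<le> S" by (simp add: S_def)
    have a: "0 < a" using S \<rho> by (simp add: a_def)
    have pw: "norm (chirp T x) powr \<rho> = (S powr (- \<rho> / 4)) ^ DIM('a) * exp (- a * (norm x)\<^sup>2)" for x :: 'a
      using S by (simp add: norm_chirp S_def[symmetric] powr_mult powr_powr exp_powr_real a_def field_simps flip: powr_realpow)
    have "(\<integral>\<^sup>+x. ennpowr (ennreal (norm (chirp T (x::'a)))) \<rho> \<partial>lborel)
        = (\<integral>\<^sup>+x. ennreal ((S powr (- \<rho> / 4)) ^ DIM('a) * exp (- a * (norm (x::'a))\<^sup>2)) \<partial>lborel)"
      by (simp add: ennpowr_ennreal pw)
    also have "\<dots> = ennreal (\<integral>x. (S powr (- \<rho> / 4)) ^ DIM('a) * exp (- a * (norm (x::'a))\<^sup>2) \<partial>lborel)"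
      by (intro nn_integral_eq_integral integrable_mult_right real_gaussian_integral a) simp
    also have "(\<integral>x. (S powr (- \<rho> / 4)) ^ DIM('a) * exp (- a * (norm (x::'a))\<^sup>2) \<partial>lborel)
        = (S powr (- \<rho> / 4)) ^ DIM('a) * sqrt (pi / a) ^ DIM('a)"
      by (simp only: integral_mult_right_zero real_gaussian_integral[OF a])
    also have "\<dots> = (sqrt (2 * pi / \<rho>) * S powr (1 / 2 - \<rho> / 4)) ^ DIM('a)"
    proof -
      have "sqrt (pi / a) = sqrt (2 * pi / \<rho>) * S powr (1 / 2)"
        using S by (simp add: a_def powr_half_sqrt flip: real_sqrt_mult)
      then have "S powr (- \<rho> / 4) * sqrt (pi / a) = sqrt (2 * pi / \<rho>) * (S powr (1 / 2) * S powr (- \<rho> / 4))"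
        by simp
      also have "S powr (1 / 2) * S powr (- \<rho> / 4) = S powr (1 / 2 - \<rho> / 4)"
        by (simp flip: powr_add)
      finally show ?thesis by (simp flip: power_mult_distrib)
    qed
    finally show ?thesis
      using False \<rho> by (simp add: Lp_norm_def Lp_ennnorm_def \<rho>_def[symmetric] ennpowr_ennreal N_def S_def)
  qed
  ultimately show ?thesis by (intro that[of N]) (auto simp: N_def)
qed

lemma chirp_in_Lp_rad:
  assumes "2 < r"
  shows "chirp T \<in> Lp_rad r"
proof -
  obtain N :: "real \<Rightarrow> real" where N: "(N \<longlongrightarrow> 0) at_top" "\<And>T. 0 \<le> N T"
      "\<And>T. Lp_norm r (chirp T :: 'a \<Rightarrow> complex) \<le> ennreal (N T)"
    by (rule Lp_norm_chirp_tendsto_0[OF assms]) blast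
  then have "Lp_norm r (chirp T :: 'a \<Rightarrow> complex) < \<infinity>"
    by (intro le_less_trans[OF N(3)[of T]]) simp
  moreover have "\<exists>F. AE x in lborel. chirp T (x :: 'a) = F (norm x)"
    unfolding chirp_def
    by (rule exI[of _ "\<lambda>s. of_real (((1 + 4 * T\<^sup>2) powr (- 1 / 4)) ^ DIM('a)) *
          exp (- inverse (2 * (1 - 2 * \<i> * of_real T)) * of_real (s\<^sup>2))"]) simp
  ultimately show ?thesis by (simp add: Lp_rad_def Lp_space_def)
qed


section \<open>Failure of the estimate\<close>

theorem corollary1p3:
  fixes p q r :: ennreal
  assumes "1 \<le> p" and "1 \<le> q" and "2 < r"
  shows "\<not> (\<exists>C::real. \<forall>f::real ^ 'd \<Rightarrow> complex. f \<in> Lp_rad r \<longrightarrow>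
           mixed_norm p q (\<lambda>t. schrodinger t (distr_of f)) \<le> ennreal C * Lp_norm r f)"
proof
  assume "\<exists>C::real. \<forall>f::real ^ 'd \<Rightarrow> complex. f \<in> Lp_rad r \<longrightarrow>
           mixed_norm p q (\<lambda>t. schrodinger t (distr_of f)) \<le> ennreal C * Lp_norm r f"
  then obtain C :: real where C: "\<And>f::real ^ 'd \<Rightarrow> complex. f \<in> Lp_rad r \<Longrightarrow>
           mixed_norm p q (\<lambda>t. schrodinger t (distr_of f)) \<le> ennreal C * Lp_norm r f"
    by blast
  obtain \<delta> :: real where \<delta>: "0 < \<delta>" "\<And>T. ennreal \<delta> \<le>
      mixed_norm p q (\<lambda>t. schrodinger t (distr_of (chirp T :: real ^ 'd \<Rightarrow> complex)))"
    by (rule mixed_norm_chirp_ge[OF assms(1,2)]) blast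
  obtain N :: "real \<Rightarrow> real" where N: "(N \<longlongrightarrow> 0) at_top" "\<And>T. 0 \<le> N T"
      "\<And>T. Lp_norm r (chirp T :: real ^ 'd \<Rightarrow> complex) \<le> ennreal (N T)"
    by (rule Lp_norm_chirp_tendsto_0[OF assms(3)]) blast
  \<comment> \<open>\<open>ennreal C\<close> is \<open>0\<close> for negative \<open>C\<close>, hence the maximum.\<close>
  have "((\<lambda>T. max C 0 * N T) \<longlongrightarrow> max C 0 * 0) at_top"
    by (intro tendsto_intros N)
  then have "\<forall>\<^sub>F T in at_top. max C 0 * N T < \<delta>"
    using \<delta>(1) by (intro order_tendstoD(2)) auto
  then obtain T where T: "max C 0 * N T < \<delta>"
    by (auto simp: eventually_at_top_linorder)
  have "ennreal \<delta> \<le> ennreal C * Lp_norm r (chirp T :: real ^ 'd \<Rightarrow> complex)"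
    using \<delta>(2) C[OF chirp_in_Lp_rad[OF assms(3)]] by (rule order_trans)
  also have "\<dots> \<le> ennreal (max C 0) * ennreal (N T)"
    by (intro mult_mono N ennreal_leI) auto
  also have "\<dots> = ennreal (max C 0 * N T)"
    using N(2) by (simp add: ennreal_mult)
  also have "\<dots> < ennreal \<delta>"
    using T \<delta>(1) by (simp add: ennreal_lessI)
  finally show False by simp
qed

end
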